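(* Let $(\mathbf d^m_{\underline i},\mathbf w^m_{\underline i},\varphi_h^m)_{m\ge 0}$ be produced by the fully discrete scheme (S) described in the context. If $|\mathbf d^0_{\underline i}|=1$ for all $\underline i\in\mathcal I_N$, then $|\mathbf d^m_{\underline i}|=1$ for all $\underline i\in\mathcal I_N$ and all time levels $m\in\mathbb N$.
   Context: Setting: $n\in\{1,2,3\}$, $\Omega=[0,1]^n$, $N\in\mathbb N$, $h=1/N$, $\Delta t>0$, $t^m=m\Delta t$. Multi-indices $\underline i=(i_1,\dots,i_n)\in\mathcal I_N=\{0,\dots,N+1\}^n$; cells $\mathcal C_{\underline i}=((i_1-1)h,i_1h]\times\dots\times((i_n-1)h,i_nh]$; interior indices $\{1,\dots,N\}^n$. $\mathbf e_j$ is the $j$th unit vector. The unknowns are $\mathbf d_{\underline i}^m,\mathbf w_{\underline i}^m\in\mathbb R^3$ (approximations in cell $\mathcal C_{\underline i}$ at time $t^m$), with $\mathbf d_h^m(x)=\mathbf d^m_{\underline i}$ for $x\in\mathcal C_{\underline i}$, and $\varphi_h^m$, a continuous piecewise linear finite element function on a simplicial uniformly shape-regular triangulation $\mathcal T$ of $\Omega$ with mesh size comparable to $h$. For $n<3$, gradients in $\mathbb R^n$ are regarded as vectors in $\mathbb R^3$ (extended by zeros) when multiplied with $\mathbf d$ via dot or cross product. Notation: $D_t a^m=(a^{m+1}-a^m)/\Delta t$, $a^{m+1/2}=(a^m+a^{m+1})/2$; $D_j^\pm a_{\underline i}=\pm(a_{\underline i\pm\mathbf e_j}-a_{\underline i})/h$,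 $\Delta_h=\sum_{j=1}^n D_j^\pm D_j^\mp$. $V_h$ is the span of the hat functions $b_i$ of interior nodes of $\mathcal T$. $\widetilde g$ is an extension to $\Omega$ of the boundary data $g$ and $\widetilde g_h^m=\sum_i\widetilde g(t^m,w_i)b_i$ is its nodal interpolant (sum over all nodes $w_i$ of $\mathcal T$). $f$ is a given source. $a_h^m(u,v)=\int_\Omega[\nabla u\cdot\nabla v+\epsilon_2(\mathbf d_h^m\cdot\nabla u)(\mathbf d_h^m\cdot\nabla v)]dx$, $F^m(v)=\int_\Omega f(t^m,x)v(x)dx$. The real parameters are $k,\sigma,\alpha,\epsilon_1,\epsilon_2$. Scheme (S): for $m=0,1,\dots$ and $\underline i\in\{1,\dots,N\}^n$, $$D_t\mathbf d^m_{\underline i}=\mathbf d^{m+1/2}_{\underline i}\times\mathbf w^{m+1/2}_{\underline i},$$ $$\sigma D_t\mathbf w^m_{\underline i}=k\Delta_h\mathbf d^{m+1/2}_{\underline i}\times\mathbf d^{m+1/2}_{\underline i}-\alpha\mathbf w^{m+1/2}_{\underline i}+\frac{\epsilon_1}{2|\mathcal C_{\underline i}|}\int_{\mathcal C_{\underline i}}\Big((\nabla\varphi_h^{m+1}\cdot\mathbf d^{m+1/2}_{\underline i})\nabla\varphi_h^m+(\nabla\varphi_h^m\cdot\mathbf d^{m+1/2}_{\underline i})\nabla\varphi_h^{m+1}\Big)dx\times\mathbf d^{m+1/2}_{\underline i},$$ $$u_{0,h}^m\in V_h\ \text{ s.t. }\ a_h^m(u_{0,h}^m,v)=F^m(v)-a_h^m(\widetilde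 g_h^m,v)\ \ \forall v\in V_h,\qquad \varphi_h^m:=u_{0,h}^m+\widetilde g_h^m,$$ with homogeneous Neumann boundary conditions $\mathbf d^m_{\underline i}=\mathbf d^m_{\underline i+\mathbf e_j}$ if $i_j=0$ and $\mathbf d^m_{\underline i+\mathbf e_j}=\mathbf d^m_{\underline i}$ if $i_j=N$, imposed at every time level $m$. *)

theory Defs
  imports "HOL-Analysis.Analysis"
begin

unbundle cross3_syntax

section \<open>The grid\<close>

text \<open>
  The space dimension is \<open>n = CARD('n)\<close>, and \<open>\<Omega> = [0,1]\<^sup>n\<close> is \<open>cbox 0 1\<close>.  Multi-indices have
  type \<open>int ^ 'n\<close> rather than \<open>nat ^ 'n\<close>, so that no index arithmetic truncates.
\<close>

definition all_indices :: "nat \<Rightarrow> (int ^ 'n) set" where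
  "all_indices N = {i. \<forall>j. 0 \<le> i $ j \<and> i $ j \<le> int N + 1}"

definition interior_indices :: "nat \<Rightarrow> (int ^ 'n) set" where
  "interior_indices N = {i. \<forall>j. 1 \<le> i $ j \<and> i $ j \<le> int N}"

definition mesh_width :: "nat \<Rightarrow> real" where
  "mesh_width N = 1 / real N"

definition cell :: "real \<Rightarrow> int ^ 'n \<Rightarrow> (real ^ 'n) set" where
  "cell h i = {x. \<forall>j. (real_of_int (i $ j) - 1) * h < x $ j \<and> x $ j \<le> real_of_int (i $ j) * h}"

definition cell_function :: "real \<Rightarrow> (int ^ 'n \<Rightarrow> 'b) \<Rightarrow> real ^ 'n \<Rightarrow> 'b" where
  "cell_function h a x = a (THE i. x \<in> cell h i)"

lemma cell_unique:
  fixes i i' :: "int ^ 'n"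
  assumes "h > 0" "x \<in> cell h i" "x \<in> cell h i'"
  shows "i = i'"
proof -
  have le: "p $ j \<le> q $ j" if "x \<in> cell h p" "x \<in> cell h q" for p q :: "int ^ 'n" and j
  proof -
    have "(real_of_int (p $ j) - 1) * h < real_of_int (q $ j) * h"
      using that unfolding cell_def by (metis (mono_tags, lifting) mem_Collect_eq order_less_le_trans)
    then have "real_of_int (p $ j) - 1 < real_of_int (q $ j)"
      using assms(1) by simp
    then show ?thesis by linarith
  qed
  show ?thesis
    using le[OF assms(2,3)] le[OF assms(3,2)] by (simp add: vec_eq_iff order_antisym)
qed

lemma cell_function_eq: "h > 0 \<Longrightarrow> x \<in> cell h i \<Longrightarrow> cell_function h a x = a i"
  unfolding cell_function_def by (metis cell_unique the_equality)

section \<open>Difference operators and averages\<close>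

definition time_diff :: "real \<Rightarrow> (nat \<Rightarrow> 'v::real_vector) \<Rightarrow> nat \<Rightarrow> 'v" where
  "time_diff dt a m = (a (Suc m) - a m) /\<^sub>R dt"

definition half_step :: "(nat \<Rightarrow> 'v::real_vector) \<Rightarrow> nat \<Rightarrow> 'v" where
  "half_step a m = (a m + a (Suc m)) /\<^sub>R 2"

definition fwd_diff :: "real \<Rightarrow> 'n \<Rightarrow> (int ^ 'n \<Rightarrow> 'v::real_vector) \<Rightarrow> int ^ 'n \<Rightarrow> 'v" where
  "fwd_diff h j a i = (a (i + axis j 1) - a i) /\<^sub>R h"

definition bwd_diff :: "real \<Rightarrow> 'n \<Rightarrow> (int ^ 'n \<Rightarrow> 'v::real_vector) \<Rightarrow> int ^ 'n \<Rightarrow> 'v" where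
  "bwd_diff h j a i = - ((a (i - axis j 1) - a i) /\<^sub>R h)"

lemma fwd_bwd_diff_commute: "fwd_diff h j (bwd_diff h j a) = bwd_diff h j (fwd_diff h j a)"
  by (simp add: fun_eq_iff fwd_diff_def bwd_diff_def algebra_simps)

definition discrete_laplacian ::
  "real \<Rightarrow> (int ^ 'n::finite \<Rightarrow> 'v::real_vector) \<Rightarrow> int ^ 'n \<Rightarrow> 'v" where
  "discrete_laplacian h a i = (\<Sum>j\<in>UNIV. fwd_diff h j (bwd_diff h j a) i)"

section \<open>Gradients\<close>

text \<open>
  Where \<open>u\<close> is not differentiable, \<open>gradient u x\<close> is an unspecified vector.  For finite element
  functions this concerns only the null set of element boundaries.
\<close>

definition gradient :: "(real ^ 'n \<Rightarrow> real) \<Rightarrow> real ^ 'n \<Rightarrow> real ^ 'n" where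
  "gradient u x = (THE D. GDERIV u x :> D)"

text \<open>
  The finite type \<open>'n\<close> carries no numbering of the coordinate directions, so one is supplied by a
  bijection \<open>\<nu>\<close> from \<open>'n\<close> to \<open>{1..n}\<close>; the component in direction \<open>j\<close> becomes the \<open>\<nu> j\<close>-th component
  of a vector in \<open>\<real>\<^sup>3\<close>, and the remaining components are zero.
\<close>

definition extend3 :: "('n \<Rightarrow> nat) \<Rightarrow> real ^ 'n::finite \<Rightarrow> real ^ 3" where
  "extend3 \<nu> v = (\<Sum>j\<in>UNIV. (v $ j) *\<^sub>R axis (of_nat (\<nu> j)) 1)"

abbreviation gradient3 :: "('n \<Rightarrow> nat) \<Rightarrow> (real ^ 'n::finite \<Rightarrow> real) \<Rightarrow> real ^ 'n \<Rightarrow> real ^ 3" where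
  "gradient3 \<nu> u x \<equiv> extend3 \<nu> (gradient u x)"

section \<open>The finite element space\<close>

definition domain_triangulation :: "(real ^ 'n) set set \<Rightarrow> bool" where
  "domain_triangulation \<T> \<longleftrightarrow>
     triangulation \<T> \<and> (\<forall>T\<in>\<T>. int CARD('n) simplex T) \<and> \<Union>\<T> = cbox 0 1"

definition insphere_diameter :: "(real ^ 'n) set \<Rightarrow> real" where
  "insphere_diameter T = Sup {2 * r | r. r \<ge> 0 \<and> (\<exists>x. cball x r \<subseteq> T)}"

definition shape_regular :: "real \<Rightarrow> (real ^ 'n) set set \<Rightarrow> bool" where
  "shape_regular \<kappa> \<T> \<longleftrightarrow> (\<forall>T\<in>\<T>. diameter T \<le> \<kappa> * insphere_diameter T)"

definition mesh_size :: "(real ^ 'n) set set \<Rightarrow> real" where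
  "mesh_size \<T> = Max (diameter ` \<T>)"

definition nodes :: "(real ^ 'n) set set \<Rightarrow> (real ^ 'n) set" where
  "nodes \<T> = {w. \<exists>T\<in>\<T>. w extreme_point_of T}"

definition interior_nodes :: "(real ^ 'n) set set \<Rightarrow> (real ^ 'n) set" where
  "interior_nodes \<T> = nodes \<T> \<inter> interior (cbox 0 1)"

definition piecewise_linear :: "(real ^ 'n) set set \<Rightarrow> (real ^ 'n \<Rightarrow> real) \<Rightarrow> bool" where
  "piecewise_linear \<T> u \<longleftrightarrow> (\<forall>T\<in>\<T>. \<exists>a c. \<forall>x\<in>T. u x = a \<bullet> x + c)"

text \<open>
  Functions on \<open>\<Omega>\<close> are total functions; hat functions are set to \<open>0\<close> outside of \<open>\<Omega>\<close>, which makes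
  them unique.
\<close>

definition is_hat :: "(real ^ 'n) set set \<Rightarrow> real ^ 'n \<Rightarrow> (real ^ 'n \<Rightarrow> real) \<Rightarrow> bool" where
  "is_hat \<T> w b \<longleftrightarrow>
     continuous_on (cbox 0 1) b \<and> piecewise_linear \<T> b \<and>
     (\<forall>v\<in>nodes \<T>. b v = (if v = w then 1 else 0)) \<and>
     (\<forall>x. x \<notin> cbox 0 1 \<longrightarrow> b x = 0)"

definition hat :: "(real ^ 'n) set set \<Rightarrow> real ^ 'n \<Rightarrow> real ^ 'n \<Rightarrow> real" where
  "hat \<T> w = (THE b. is_hat \<T> w b)"

definition fe_space :: "(real ^ 'n) set set \<Rightarrow> (real ^ 'n \<Rightarrow> real) set" where
  "fe_space \<T> = {\<lambda>x. \<Sum>w\<in>interior_nodes \<T>. c w * hat \<T> w x | c. True}"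

definition nodal_interpolant ::
  "(real ^ 'n) set set \<Rightarrow> (real ^ 'n \<Rightarrow> real) \<Rightarrow> real ^ 'n \<Rightarrow> real" where
  "nodal_interpolant \<T> u x = (\<Sum>w\<in>nodes \<T>. u w * hat \<T> w x)"

lemma affine_interpolation:
  fixes C :: "'a::euclidean_space set"
  assumes "\<not> affine_dependent C"
  shows "\<exists>a c. \<forall>v\<in>C. a \<bullet> v + c = f v"
proof (cases "C = {}")
  case False
  then obtain p where p: "p \<in> C" by blast
  let ?B = "(\<lambda>v. - p + v) ` (C - {p})"
  have "independent ?B"
    using assms affine_dependent_iff_dependent2[OF p] by simp
  then obtain g :: "'a \<Rightarrow> real" where g: "linear g" "\<forall>y\<in>?B. g y = f (p + y) - f p"
    using linear_independent_extend[of ?B "\<lambda>y. f (p + y) - f p"] by blast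
  have ga: "g y = adjoint g 1 \<bullet> y" for y
    using adjoint_clauses(2)[OF g(1), of 1 y] by simp
  have "adjoint g 1 \<bullet> v + (f p - adjoint g 1 \<bullet> p) = f v" if "v \<in> C" for v
  proof (cases "v = p")
    case False
    then have "g (- p + v) = f v - f p" using g(2) that by force
    then show ?thesis by (simp add: ga inner_add_right inner_diff_right)
  qed simp
  then show ?thesis by blast
qed simp

lemma affine_eq_on_hull:
  fixes C :: "'a::euclidean_space set"
  assumes "\<forall>v\<in>C. a \<bullet> v + c = a' \<bullet> v + c'" "x \<in> convex hull C"
  shows "a \<bullet> x + c = a' \<bullet> x + c'"
proof -
  have "convex hull C \<subseteq> {x. (a - a') \<bullet> x = c' - c}"
    using assms(1) by (intro hull_minimal convex_hyperplane) (auto simp: inner_diff_left algebra_simps)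
  then show ?thesis using assms(2) by (auto simp: inner_diff_left algebra_simps)
qed

lemma simplex_vertices:
  assumes "n simplex T"
  shows "T = convex hull {v. v extreme_point_of T}" "\<not> affine_dependent {v. v extreme_point_of T}"
proof -
  obtain C where C: "\<not> affine_dependent C" "T = convex hull C"
    using assms unfolding simplex_def by blast
  then have "{v. v extreme_point_of T} = C"
    using extreme_point_of_convex_hull_affine_independent[OF C(1)] by auto
  then show "T = convex hull {v. v extreme_point_of T}" "\<not> affine_dependent {v. v extreme_point_of T}"
    using C by auto
qed

lemma hat_exists_unique:
  fixes \<T> :: "(real ^ 'n) set set"
  assumes "domain_triangulation \<T>"
  shows "\<exists>!b. is_hat \<T> w b"
proof -
  have tri: "triangulation \<T>" and un: "\<Union>\<T> = cbox 0 1"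
    and simp: "\<And>T. T \<in> \<T> \<Longrightarrow> int CARD('n) simplex T"
    using assms by (auto simp: domain_triangulation_def)
  have fin: "finite \<T>"
    and face: "\<And>T T'. T \<in> \<T> \<Longrightarrow> T' \<in> \<T> \<Longrightarrow> (T \<inter> T') face_of T"
    using tri by (auto simp: triangulation_def)
  let ?V = "\<lambda>T. {v. v extreme_point_of (T :: (real ^ 'n) set)}"
  let ?\<delta> = "\<lambda>v. if v = w then 1 else (0::real)"
  have "\<forall>T\<in>\<T>. \<exists>a c. \<forall>v\<in>?V T. a \<bullet> v + c = ?\<delta> v"
    by (intro ballI affine_interpolation simplex_vertices(2)[OF simp])
  then obtain A K where AK: "\<And>T v. T \<in> \<T> \<Longrightarrow> v \<in> ?V T \<Longrightarrow> A T \<bullet> v + K T = ?\<delta> v"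
    by metis
  have agree: "A T \<bullet> x + K T = A T' \<bullet> x + K T'"
    if T: "T \<in> \<T>" "T' \<in> \<T>" and x: "x \<in> T" "x \<in> T'" for T T' x
  proof -
    have f1: "(T \<inter> T') face_of T" using face T by blast
    have f2: "(T \<inter> T') face_of T'" using face[OF T(2,1)] by (simp add: Int_commute)
    have "compact (T \<inter> T')" "convex (T \<inter> T')"
      using compact_simplex[OF simp[OF T(1)]] compact_simplex[OF simp[OF T(2)]]
        convex_simplex[OF simp[OF T(1)]] convex_simplex[OF simp[OF T(2)]]
      by (auto intro: compact_Int convex_Int)
    then have "T \<inter> T' = convex hull ?V (T \<inter> T')"
      by (rule Krein_Milman_Minkowski)
    moreover have "?V (T \<inter> T') \<subseteq> ?V T \<inter> ?V T'"
      using extreme_point_of_face[OF f1] extreme_point_of_face[OF f2] by auto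
    then have "\<forall>v\<in>?V (T \<inter> T'). A T \<bullet> v + K T = A T' \<bullet> v + K T'"
      using AK[OF T(1)] AK[OF T(2)] by (metis (mono_tags, lifting) IntE subsetD)
    ultimately show ?thesis
      using affine_eq_on_hull x by blast
  qed
  define b where "b x = (if x \<in> cbox 0 1 then
      A (SOME T. T \<in> \<T> \<and> x \<in> T) \<bullet> x + K (SOME T. T \<in> \<T> \<and> x \<in> T) else 0)" for x
  have b: "b x = A T \<bullet> x + K T" if "T \<in> \<T>" "x \<in> T" for T x
  proof -
    have "(SOME T. T \<in> \<T> \<and> x \<in> T) \<in> \<T> \<and> x \<in> (SOME T. T \<in> \<T> \<and> x \<in> T)"
      using that by (intro someI[of "\<lambda>T. T \<in> \<T> \<and> x \<in> T"]) auto
    then have "A (SOME T. T \<in> \<T> \<and> x \<in> T) \<bullet> x + K (SOME T. T \<in> \<T> \<and> x \<in> T) = A T \<bullet> x + K T"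
      using agree that by blast
    moreover have "x \<in> cbox 0 1" using that un by blast
    ultimately show ?thesis by (simp add: b_def)
  qed
  have "continuous_on (\<Union>T\<in>\<T>. T) b"
  proof (rule continuous_on_closed_Union[OF fin])
    fix T assume T: "T \<in> \<T>"
    show "closed T" using closed_simplex[OF simp[OF T]] .
    have "continuous_on T (\<lambda>x. A T \<bullet> x + K T)" by (intro continuous_intros)
    moreover have "continuous_on T b \<longleftrightarrow> continuous_on T (\<lambda>x. A T \<bullet> x + K T)"
      by (rule continuous_on_cong) (simp_all add: b[OF T])
    ultimately show "continuous_on T b" by simp
  qed
  then have "continuous_on (cbox 0 1) b" using un by simp
  moreover have "piecewise_linear \<T> b" unfolding piecewise_linear_def using b by blast
  moreover have "b v = ?\<delta> v" if v: "v \<in> nodes \<T>" for v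
  proof -
    obtain T where T: "T \<in> \<T>" "v \<in> ?V T" using v by (auto simp: nodes_def)
    then have "v \<in> T" by (auto simp: extreme_point_of_def)
    then show ?thesis using b[OF T(1)] AK[OF T] by simp
  qed
  ultimately have ex: "is_hat \<T> w b" by (auto simp: is_hat_def b_def)
  have "p x = q x" if p: "is_hat \<T> w p" and q: "is_hat \<T> w q" for p q x
  proof (cases "x \<in> cbox 0 1")
    case True
    then obtain T where T: "T \<in> \<T>" "x \<in> T" using un by blast
    obtain a c where ac: "\<forall>x\<in>T. p x = a \<bullet> x + c"
      using p T unfolding is_hat_def piecewise_linear_def by meson
    obtain a' c' where ac': "\<forall>x\<in>T. q x = a' \<bullet> x + c'"
      using q T unfolding is_hat_def piecewise_linear_def by meson
    have "a \<bullet> v + c = a' \<bullet> v + c'" if "v \<in> ?V T" for v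
    proof -
      have "v \<in> T" "v \<in> nodes \<T>" using that T by (auto simp: nodes_def extreme_point_of_def)
      then have "p v = q v" using p q by (simp add: is_hat_def)
      then show ?thesis using ac ac' \<open>v \<in> T\<close> by simp
    qed
    then have "a \<bullet> x + c = a' \<bullet> x + c'"
      using affine_eq_on_hull simplex_vertices(1)[OF simp[OF T(1)]] T(2) by blast
    then show ?thesis using ac ac' T(2) by simp
  next
    case False
    then show ?thesis using p q by (simp add: is_hat_def)
  qed
  then show ?thesis using ex by blast
qed

lemma is_hat_hat: "domain_triangulation \<T> \<Longrightarrow> is_hat \<T> w (hat \<T> w)"
  unfolding hat_def by (rule theI'[OF hat_exists_unique])

section \<open>The scheme\<close>

definition elliptic_form ::
  "('n \<Rightarrow> nat) \<Rightarrow> real \<Rightarrow> (real ^ 'n::finite \<Rightarrow> real ^ 3) \<Rightarrow>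
   (real ^ 'n \<Rightarrow> real) \<Rightarrow> (real ^ 'n \<Rightarrow> real) \<Rightarrow> real" where
  "elliptic_form \<nu> \<epsilon>2 dh u v =
     (LINT x : cbox 0 1 | lebesgue.
        gradient u x \<bullet> gradient v x
        + \<epsilon>2 * ((dh x \<bullet> gradient3 \<nu> u x) * (dh x \<bullet> gradient3 \<nu> v x)))"

definition load :: "(real \<Rightarrow> real ^ 'n \<Rightarrow> real) \<Rightarrow> real \<Rightarrow> (real ^ 'n \<Rightarrow> real) \<Rightarrow> real" where
  "load f t v = (LINT x : cbox 0 1 | lebesgue. f t x * v x)"

definition director_eq ::
  "nat \<Rightarrow> real \<Rightarrow> (nat \<Rightarrow> int ^ 'n \<Rightarrow> real ^ 3) \<Rightarrow> (nat \<Rightarrow> int ^ 'n \<Rightarrow> real ^ 3) \<Rightarrow> bool" where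
  "director_eq N dt d w \<longleftrightarrow>
     (\<forall>m. \<forall>i\<in>interior_indices N.
        time_diff dt (\<lambda>l. d l i) m = half_step (\<lambda>l. d l i) m \<times> half_step (\<lambda>l. w l i) m)"

definition angular_momentum_eq ::
  "('n \<Rightarrow> nat) \<Rightarrow> nat \<Rightarrow> real \<Rightarrow> real \<Rightarrow> real \<Rightarrow> real \<Rightarrow> real \<Rightarrow>
   (nat \<Rightarrow> int ^ 'n::finite \<Rightarrow> real ^ 3) \<Rightarrow> (nat \<Rightarrow> int ^ 'n \<Rightarrow> real ^ 3) \<Rightarrow>
   (nat \<Rightarrow> real ^ 'n \<Rightarrow> real) \<Rightarrow> bool" where
  "angular_momentum_eq \<nu> N dt k \<sigma> \<alpha> \<epsilon>1 d w \<phi> \<longleftrightarrow>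
     (\<forall>m. \<forall>i\<in>interior_indices N.
        let h = mesh_width N;
            C = cell h i;
            dm = half_step (\<lambda>l. d l i) m;
            wm = half_step (\<lambda>l. w l i) m
        in \<sigma> *\<^sub>R time_diff dt (\<lambda>l. w l i) m =
             (k *\<^sub>R discrete_laplacian h (\<lambda>i'. half_step (\<lambda>l. d l i') m) i) \<times> dm
             - \<alpha> *\<^sub>R wm
             + ((\<epsilon>1 / (2 * measure lebesgue C)) *\<^sub>R
                 (LINT x : C | lebesgue.
                    (gradient3 \<nu> (\<phi> (Suc m)) x \<bullet> dm) *\<^sub>R gradient3 \<nu> (\<phi> m) x
                    + (gradient3 \<nu> (\<phi> m) x \<bullet> dm) *\<^sub>R gradient3 \<nu> (\<phi> (Suc m)) x)) \<times> dm)"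

definition potential_eq ::
  "('n \<Rightarrow> nat) \<Rightarrow> nat \<Rightarrow> real \<Rightarrow> real \<Rightarrow> (real ^ 'n::finite) set set \<Rightarrow>
   (real \<Rightarrow> real ^ 'n \<Rightarrow> real) \<Rightarrow> (real \<Rightarrow> real ^ 'n \<Rightarrow> real) \<Rightarrow>
   (nat \<Rightarrow> int ^ 'n \<Rightarrow> real ^ 3) \<Rightarrow> (nat \<Rightarrow> real ^ 'n \<Rightarrow> real) \<Rightarrow> bool" where
  "potential_eq \<nu> N dt \<epsilon>2 \<T> f gt d \<phi> \<longleftrightarrow>
     (\<forall>m. let t = real m * dt;
              a = elliptic_form \<nu> \<epsilon>2 (cell_function (mesh_width N) (d m));
              gh = nodal_interpolant \<T> (gt t)
          in \<exists>u0\<in>fe_space \<T>.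
               (\<forall>v\<in>fe_space \<T>. a u0 v = load f t v - a gh v) \<and>
               \<phi> m = (\<lambda>x. u0 x + gh x))"

text \<open>
  The condition ranges over all of \<open>{0..N+1}\<^sup>n\<close>, so it also determines the values at edge and corner
  ghost indices, where several components are \<open>0\<close> or \<open>N + 1\<close>.
\<close>

definition neumann_bc :: "nat \<Rightarrow> (nat \<Rightarrow> int ^ 'n \<Rightarrow> real ^ 3) \<Rightarrow> bool" where
  "neumann_bc N d \<longleftrightarrow>
     (\<forall>m. \<forall>i\<in>all_indices N. \<forall>j.
        (i $ j = 0 \<longrightarrow> d m i = d m (i + axis j 1)) \<and>
        (i $ j = int N \<longrightarrow> d m (i + axis j 1) = d m i))"

definition discrete_scheme ::
  "('n \<Rightarrow> nat) \<Rightarrow> nat \<Rightarrow> real \<Rightarrow> real \<Rightarrow> real \<Rightarrow> real \<Rightarrow> real \<Rightarrow> real \<Rightarrow>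
   (real ^ 'n::finite) set set \<Rightarrow> (real \<Rightarrow> real ^ 'n \<Rightarrow> real) \<Rightarrow> (real \<Rightarrow> real ^ 'n \<Rightarrow> real) \<Rightarrow>
   (nat \<Rightarrow> int ^ 'n \<Rightarrow> real ^ 3) \<Rightarrow> (nat \<Rightarrow> int ^ 'n \<Rightarrow> real ^ 3) \<Rightarrow>
   (nat \<Rightarrow> real ^ 'n \<Rightarrow> real) \<Rightarrow> bool" where
  "discrete_scheme \<nu> N dt k \<sigma> \<alpha> \<epsilon>1 \<epsilon>2 \<T> f gt d w \<phi> \<longleftrightarrow>
     director_eq N dt d w \<and>
     angular_momentum_eq \<nu> N dt k \<sigma> \<alpha> \<epsilon>1 d w \<phi> \<and>
     potential_eq \<nu> N dt \<epsilon>2 \<T> f gt d \<phi> \<and>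
     neumann_bc N d"

unbundle no cross3_syntax

end

theory Submission
  imports Defs
begin

text \<open>
  In interior cells the increment of \<open>d\<close> is orthogonal to the midpoint \<open>d\<^sup>m\<^sup>+\<^sup>1\<^sup>/\<^sup>2\<close>, being a cross product
  with it, and \<open>(b - a) \<bullet> (a + b) = |b|\<^sup>2 - |a|\<^sup>2\<close>.  The Neumann condition makes every ghost value a copy
  of an interior value, found by moving off the ghost layers one coordinate direction at a time.
\<close>

lemma half_step_orthogonal_imp_norm_eq:
  fixes a :: "nat \<Rightarrow> 'v::real_inner"
  assumes "dt \<noteq> 0" and "half_step a m \<bullet> time_diff dt a m = 0"
  shows "norm (a (Suc m)) = norm (a m)"
proof -
  \<comment> \<open>The factors 1/2 and \<open>inverse dt\<close> cancel. For \<open>dt = 0\<close>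
    the difference quotient would be 0 by convention and orthogonality would carry no
    information.\<close>
  have "(a m + a (Suc m)) \<bullet> (a (Suc m) - a m) = 0"
    using assms by (simp add: half_step_def time_diff_def)
  then have "a (Suc m) \<bullet> a (Suc m) = a m \<bullet> a m"
    by (simp add: inner_add_left inner_add_right inner_diff_left inner_diff_right inner_commute)
  then show ?thesis
    by (simp add: norm_eq)
qed

text \<open>Induction on time; the cross product is orthogonal to its first factor whatever
  \<open>w\<close> is. Interior indices are those where the director equation is imposed.\<close>

lemma director_eq_norm_const:
  assumes "director_eq N dt d w" and "dt \<noteq> 0" and "i \<in> interior_indices N"
  shows "norm (d m i) = norm (d 0 i)"
proof (induction m)
  case (Suc m)
  have "half_step (\<lambda>l. d l i) m \<bullet> time_diff dt (\<lambda>l. d l i) m = 0"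
    using assms(1,3) by (simp add: director_eq_def dot_cross_self)
  from half_step_orthogonal_imp_norm_eq[OF assms(2) this] Suc show ?case
    by simp
qed simp

text \<open>The index shifts do not depend on time, so one \<open>i'\<close> serves all
  \<open>m\<close>; this is what lets time \<open>m\<close> be compared with time 0.\<close>

lemma neumann_bc_interior_copy:
  fixes i :: "int ^ 'n::finite"
  assumes "neumann_bc N d" and "N \<ge> 1" and "i \<in> all_indices N"
  shows "\<exists>i'\<in>interior_indices N. \<forall>m. d m i = d m i'"
  using assms(3)
\<comment> \<open>The measure counts ghost components, of which edge and corner indices have
  several.\<close>
proof (induction "card {j. i $ j = 0 \<or> i $ j = int N + 1}" arbitrary: i rule: less_induct)
  case less
  let ?G = "\<lambda>i :: int ^ 'n. {j. i $ j = 0 \<or> i $ j = int N + 1}"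
  show ?case
  proof (cases "?G i = {}")
    case True
    have "1 \<le> i $ j \<and> i $ j \<le> int N" for j
    proof -
      have "0 \<le> i $ j \<and> i $ j \<le> int N + 1"
        using less.prems by (simp add: all_indices_def)
      moreover have "i $ j \<noteq> 0 \<and> i $ j \<noteq> int N + 1"
        using True by blast
      ultimately show ?thesis
        by linarith
    qed
    then show ?thesis
      by (auto simp: interior_indices_def)
  next
    case False
    then obtain j where j: "i $ j = 0 \<or> i $ j = int N + 1"
      by blast
    define i' where "i' = (if i $ j = 0 then i + axis j 1 else i - axis j 1)"
    have i'_j: "i' $ j = (if i $ j = 0 then 1 else int N)"
      and i'_other: "\<And>l. l \<noteq> j \<Longrightarrow> i' $ l = i $ l"
      using j by (auto simp: i'_def axis_def)
    have i': "i' \<in> all_indices N"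
      unfolding all_indices_def
    proof (intro CollectI allI)
      fix l
      show "0 \<le> i' $ l \<and> i' $ l \<le> int N + 1"
        using less.prems i'_j i'_other assms(2) by (cases "l = j") (auto simp: all_indices_def)
    qed
    have copy: "d m i = d m i'" for m
    proof (cases "i $ j = 0")
      case True
      then show ?thesis
        using assms(1) less.prems by (simp add: neumann_bc_def i'_def)
    next
      case False
      \<comment> \<open>The upper condition is stated at component \<open>N\<close>, so it is
        applied at \<open>i'\<close>, not at \<open>i\<close>; hence \<open>i'\<close> had to be
        placed in the grid first.\<close>
      then have "d m (i' + axis j 1) = d m i'"
        using assms(1) i' i'_j by (simp add: neumann_bc_def)
      with False show ?thesis
        by (simp add: i'_def)
    qed
    \<comment> \<open>The new component is 1 or \<open>N\<close>, and \<open>N \<ge> 1\<close> keeps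
      both away from 0 and \<open>N + 1\<close>.\<close>
    have "j \<notin> ?G i'"
      using i'_j assms(2) by auto
    moreover have "?G i' \<subseteq> ?G i"
    proof
      fix l
      assume "l \<in> ?G i'"
      moreover from this \<open>j \<notin> ?G i'\<close> have "l \<noteq> j"
        by blast
      ultimately show "l \<in> ?G i"
        using i'_other by simp
    qed
    moreover have "j \<in> ?G i"
      using j by simp
    ultimately have "?G i' \<subset> ?G i"
      by blast
    then have "card (?G i') < card (?G i)"
      by (intro psubset_card_mono) simp_all
    from less.hyps[OF this i'] copy show ?thesis
      by simp
  qed
qed

theorem lemma2p1:
  fixes \<nu> :: "'n::finite \<Rightarrow> nat"
    and N :: nat
    and dt k \<sigma> \<alpha> \<epsilon>1 \<epsilon>2 \<kappa> c1 c2 :: real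
    and \<T> :: "(real ^ 'n) set set"
    and f g gt :: "real \<Rightarrow> real ^ 'n \<Rightarrow> real"
    and d w :: "nat \<Rightarrow> int ^ 'n \<Rightarrow> real ^ 3"
    and \<phi> :: "nat \<Rightarrow> real ^ 'n \<Rightarrow> real"
  assumes dim: "CARD('n) \<in> {1, 2, 3}"
    and numbering: "bij_betw \<nu> UNIV {1..CARD('n)}"
    and N: "N \<ge> 1"
    and dt: "dt > 0"
    and triangulation: "domain_triangulation \<T>"
    and regular: "\<kappa> > 0" "shape_regular \<kappa> \<T>"
    and comparable: "c1 > 0" "c2 > 0"
      "c1 * mesh_width N \<le> mesh_size \<T>" "mesh_size \<T> \<le> c2 * mesh_width N"
    and extension: "\<forall>t\<ge>0. \<forall>x\<in>frontier (cbox 0 1). gt t x = g t x"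
    and scheme: "discrete_scheme \<nu> N dt k \<sigma> \<alpha> \<epsilon>1 \<epsilon>2 \<T> f gt d w \<phi>"
    and initial: "\<forall>i\<in>all_indices N. norm (d 0 i) = 1"
  shows "\<forall>m. \<forall>i\<in>all_indices N. norm (d m i) = 1"
proof (intro allI ballI)
  fix m and i :: "int ^ 'n"
  assume i: "i \<in> all_indices N"
  have director: "director_eq N dt d w" and neumann: "neumann_bc N d"
    using scheme by (simp_all add: discrete_scheme_def)
  obtain i' where i': "i' \<in> interior_indices N" and copy: "\<And>m. d m i = d m i'"
    using neumann_bc_interior_copy[OF neumann N i] by blast
  \<comment> \<open>\<open>copy\<close> moves both sides to \<open>i'\<close>, where the norm is
    conserved.\<close>
  have "norm (d m i) = norm (d 0 i)"
    using director_eq_norm_const[OF director _ i'] dt by (simp add: copy)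
  then show "norm (d m i) = 1"
    using initial i by simp
qed

end
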